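(* Let $m \ge n \ge 3$ be integers, let $\mathcal{V} \subseteq C[-1,1]$ be an $n$-dimensional Chebyshev space containing the constant functions, with basis $(v_1,\ldots,v_n)$, and let $-1 \le x^{(1)} < \cdots < x^{(m)} \le 1$. Set $x^{(0)}=-1$, $x^{(m+1)}=1$, and let $K$ be the set of those $k \in \{1,\ldots,m+1\}$ with $x^{(k-1)} < x^{(k)}$. Let $M \in \mathbb{R}^{n\times m}$ have entries $M_{j,i} = v_j(x^{(i)})$, and for $x \in [-1,1]$ let $b(x) = [v_1(x);\ldots;v_n(x)] \in \mathbb{R}^n$. For each $k \in K$, let $z^{(k)} \in (x^{(k-1)},x^{(k)})$ and let $S_k \subseteq \{1,\ldots,m\}$ be an index set of size $|S_k|=n$ such that the vector $a^{(k)} \in \mathbb{R}^m$ supported on $S_k$ and satisfying $a^{(k)}_{S_k} = M_{S_k}^{-1} b(z^{(k)})$ is a solution to $$\underset{a \in \mathbb{R}^m}{\rm minimize}\; \|a\|_1 \qquad \text{subject to } Ma = b(z^{(k)}).$$ Then the maximal ratio of uniform and discrete norms over $\mathcal{V}$, $$\rho_{\mathcal{V},{\bm X}} := \max_{v \in \mathcal{V}\setminus\{0\}} \frac{\max_{x\in[-1,1]}|v(x)|}{\max_{i \in \{1,\ldots,m\}} |v(x^{(i)})|},$$ satisfies $$\rho_{\mathcal{V},{\bm X}} = \max_{k \in K}\ \max_{x \in [x^{(k-1)},x^{(k)}]}\ \sum_{j \in S_k} {\rm sgn}\big( (M_{S_k}^{-1} b(z^{(k)}))_j \big)\, (M_{S_k}^{-1}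 b(x))_j .$$
   Context: $C[-1,1]$ is the space of real-valued continuous functions on $[-1,1]$. An $n$-dimensional subspace $\mathcal{V}$ of $C[-1,1]$ is a Chebyshev space if, for any distinct points $\xi^{(1)},\ldots,\xi^{(n)} \in [-1,1]$ and any values $\gamma_1,\ldots,\gamma_n\in\mathbb{R}$, there is a unique $v \in \mathcal{V}$ with $v(\xi^{(i)}) = \gamma_i$ for all $i\in\{1,\ldots,n\}$. For $S \subseteq \{1,\ldots,m\}$ with $|S| = n$, $a_S \in \mathbb{R}^n$ denotes the subvector of $a\in\mathbb{R}^m$ with entries indexed by $S$, and $M_S \in \mathbb{R}^{n\times n}$ the submatrix of $M$ with columns indexed by $S$ (invertible when $\mathcal{V}$ is a Chebyshev space and the points are distinct); the entries of $M_S^{-1}b$ are indexed by $S$. A vector $a$ is supported on $S$ if $a_i = 0$ for $i \notin S$. $\|a\|_1 = \sum_i |a_i|$. ${\bm X}$ denotes the point set $\{x^{(1)},\ldots,x^{(m)}\}$. Index sets $S_k$ with the required property always exist. *)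

theory Defs
  imports "HOL-Analysis.Analysis"
begin

text \<open>The space \<open>C[-1,1]\<close>. A continuous function on \<open>[-1,1]\<close> is represented by its extension
  by zero to the whole line, so that two elements are equal iff they agree on \<open>[-1,1]\<close>.\<close>

typedef C11 = "{f :: real \<Rightarrow> real. continuous_on {-1..1} f \<and> (\<forall>x. x \<notin> {-1..1} \<longrightarrow> f x = 0)}"
  morphisms app C11
  by (rule exI[of _ "\<lambda>_. 0"]) simp

setup_lifting type_definition_C11

instantiation C11 :: real_vector
begin

lift_definition zero_C11 :: C11 is "\<lambda>_. 0"
  by simp

lift_definition plus_C11 :: "C11 \<Rightarrow> C11 \<Rightarrow> C11" is "\<lambda>f g x. f x + g x"
  by (auto intro: continuous_on_add)

lift_definition uminus_C11 :: "C11 \<Rightarrow> C11" is "\<lambda>f x. - f x"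
  by (auto intro: continuous_on_minus)

lift_definition minus_C11 :: "C11 \<Rightarrow> C11 \<Rightarrow> C11" is "\<lambda>f g x. f x - g x"
  by (auto intro: continuous_on_diff)

lift_definition scaleR_C11 :: "real \<Rightarrow> C11 \<Rightarrow> C11" is "\<lambda>c f x. c * f x"
  by (auto intro: continuous_on_mult_left)

instance
  by standard (transfer; auto simp: algebra_simps)+

end

lift_definition const_C11 :: "real \<Rightarrow> C11" is "\<lambda>c x. if x \<in> {-1..1} then c else 0"
proof -
  fix c :: real
  have "continuous_on {-1..1} (\<lambda>x::real. if x \<in> {-1..1} then c else 0)
      = continuous_on {-1..1} (\<lambda>x::real. c)"
    by (rule continuous_on_cong) auto
  then show "continuous_on {-1..1} (\<lambda>x::real. if x \<in> {-1..1} then c else 0) \<and>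
      (\<forall>x. x \<notin> {-1..1} \<longrightarrow> (if x \<in> {-1..1} then c else 0) = 0)"
    by simp
qed

definition chebyshev_space :: "nat \<Rightarrow> C11 set \<Rightarrow> bool" where
  "chebyshev_space n V \<longleftrightarrow> subspace V \<and> dim V = n \<and>
     (\<forall>(\<xi> :: nat \<Rightarrow> real) (\<gamma> :: nat \<Rightarrow> real).
        inj_on \<xi> {1..n} \<and> \<xi> ` {1..n} \<subseteq> {-1..1} \<longrightarrow>
        (\<exists>!v. v \<in> V \<and> (\<forall>i\<in>{1..n}. app v (\<xi> i) = \<gamma> i)))"

definition is_basis :: "nat \<Rightarrow> (nat \<Rightarrow> C11) \<Rightarrow> C11 set \<Rightarrow> bool" where
  "is_basis n v V \<longleftrightarrow> inj_on v {1..n} \<and> independent (v ` {1..n}) \<and> span (v ` {1..n}) = V"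

text \<open>Vectors and matrices are functions on natural-number indices, considered only on explicit
  finite index sets; values outside these sets are irrelevant. This allows the submatrix \<open>M\<^sub>S\<close>
  to keep \<open>S\<close> itself as its column index set.\<close>

definition mat_vec :: "nat set \<Rightarrow> (nat \<Rightarrow> nat \<Rightarrow> real) \<Rightarrow> (nat \<Rightarrow> real) \<Rightarrow> nat \<Rightarrow> real" where
  "mat_vec J A y = (\<lambda>i. \<Sum>j\<in>J. A i j * y j)"

text \<open>\<open>is_mat_inverse I J A B\<close>: for \<open>A\<close> with rows \<open>I\<close> and columns \<open>J\<close>, the matrix \<open>B\<close> (rows \<open>J\<close>,
  columns \<open>I\<close>) satisfies \<open>A B = 1\<close> and \<open>B A = 1\<close>.\<close>

definition is_mat_inverse ::
    "nat set \<Rightarrow> nat set \<Rightarrow> (nat \<Rightarrow> nat \<Rightarrow> real) \<Rightarrow> (nat \<Rightarrow> nat \<Rightarrow> real) \<Rightarrow> bool" where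
  "is_mat_inverse I J A B \<longleftrightarrow>
     (\<forall>i\<in>I. \<forall>k\<in>I. (\<Sum>j\<in>J. A i j * B j k) = (if i = k then 1 else 0)) \<and>
     (\<forall>j\<in>J. \<forall>l\<in>J. (\<Sum>i\<in>I. B j i * A i l) = (if j = l then 1 else 0))"

text \<open>The entries indexed by \<open>J \<times> I\<close> are uniquely determined whenever an inverse exists.\<close>

definition mat_inverse ::
    "nat set \<Rightarrow> nat set \<Rightarrow> (nat \<Rightarrow> nat \<Rightarrow> real) \<Rightarrow> nat \<Rightarrow> nat \<Rightarrow> real" where
  "mat_inverse I J A = (SOME B. is_mat_inverse I J A B)"

definition colloc_mat :: "(nat \<Rightarrow> C11) \<Rightarrow> (nat \<Rightarrow> real) \<Rightarrow> nat \<Rightarrow> nat \<Rightarrow> real" where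
  "colloc_mat v x = (\<lambda>j i. app (v j) (x i))"

definition eval_vec :: "(nat \<Rightarrow> C11) \<Rightarrow> real \<Rightarrow> nat \<Rightarrow> real" where
  "eval_vec v t = (\<lambda>j. app (v j) t)"

text \<open>The vector \<open>M\<^sub>S\<^sup>-\<^sup>1 b(t)\<close>, with entries indexed by \<open>S\<close>.\<close>

definition inv_eval ::
    "nat \<Rightarrow> (nat \<Rightarrow> C11) \<Rightarrow> (nat \<Rightarrow> real) \<Rightarrow> nat set \<Rightarrow> real \<Rightarrow> nat \<Rightarrow> real" where
  "inv_eval n v x S t =
     mat_vec {1..n} (mat_inverse {1..n} S (colloc_mat v x)) (eval_vec v t)"

definition l1_norm :: "nat \<Rightarrow> (nat \<Rightarrow> real) \<Rightarrow> real" where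
  "l1_norm m a = (\<Sum>i\<in>{1..m}. \<bar>a i\<bar>)"

definition l1_feasible ::
    "nat \<Rightarrow> nat \<Rightarrow> (nat \<Rightarrow> nat \<Rightarrow> real) \<Rightarrow> (nat \<Rightarrow> real) \<Rightarrow> (nat \<Rightarrow> real) \<Rightarrow> bool" where
  "l1_feasible n m M b a \<longleftrightarrow> (\<forall>j\<in>{1..n}. mat_vec {1..m} M a j = b j)"

definition l1_solution ::
    "nat \<Rightarrow> nat \<Rightarrow> (nat \<Rightarrow> nat \<Rightarrow> real) \<Rightarrow> (nat \<Rightarrow> real) \<Rightarrow> (nat \<Rightarrow> real) \<Rightarrow> bool" where
  "l1_solution n m M b a \<longleftrightarrow> l1_feasible n m M b a \<and>
     (\<forall>a'. l1_feasible n m M b a' \<longrightarrow> l1_norm m a \<le> l1_norm m a')"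

text \<open>A maximum over a possibly infinite set is written as a \<open>SUP\<close> together with the
  assertion \<open>attains_max\<close> that the supremum is attained; for \<open>uniform_norm\<close> below attainment is
  automatic, by continuity on a compact interval.\<close>

definition attains_max :: "'a set \<Rightarrow> ('a \<Rightarrow> real) \<Rightarrow> bool" where
  "attains_max A f \<longleftrightarrow> (\<exists>x\<in>A. \<forall>y\<in>A. f y \<le> f x)"

definition uniform_norm :: "C11 \<Rightarrow> real" where
  "uniform_norm f = (SUP t\<in>{-1..1}. \<bar>app f t\<bar>)"

definition discrete_norm :: "nat \<Rightarrow> (nat \<Rightarrow> real) \<Rightarrow> C11 \<Rightarrow> real" where
  "discrete_norm m x f = Max ((\<lambda>i. \<bar>app f (x i)\<bar>) ` {1..m})"

definition norm_ratio :: "nat \<Rightarrow> (nat \<Rightarrow> real) \<Rightarrow> C11 \<Rightarrow> real" where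
  "norm_ratio m x f = uniform_norm f / discrete_norm m x f"

definition max_ratio :: "C11 set \<Rightarrow> nat \<Rightarrow> (nat \<Rightarrow> real) \<Rightarrow> real" where
  "max_ratio V m x = (SUP f\<in>V - {0}. norm_ratio m x f)"

definition sign_sum ::
    "nat \<Rightarrow> (nat \<Rightarrow> C11) \<Rightarrow> (nat \<Rightarrow> real) \<Rightarrow> nat set \<Rightarrow> real \<Rightarrow> real \<Rightarrow> real" where
  "sign_sum n v x S z t = (\<Sum>j\<in>S. sgn (inv_eval n v x S z j) * inv_eval n v x S t j)"

end

theory Submission
  imports Defs
begin

text \<open>On the interval \<open>[x\<^bsub>k-1\<^esub>, x\<^bsub>k\<^esub>]\<close> the Lagrange functions \<open>l\<^sub>j\<close> of the nodes in \<open>S\<^sub>k\<close> do not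
  change sign, because a nonzero element of a Chebyshev space of dimension \<open>n\<close> has at most \<open>n - 1\<close>
  zeros. So \<open>p\<^sub>k = \<Sum>\<^sub>j sgn (l\<^sub>j(z\<^sub>k)) l\<^sub>j\<close> equals \<open>\<Sum>\<^sub>j \<bar>l\<^sub>j\<bar>\<close> there, which by Lagrange interpolation
  dominates every \<open>v \<in> V\<close> with \<open>\<bar>v(x\<^sub>i)\<bar> \<le> 1\<close>. Conversely, \<open>p\<^sub>k\<close> itself satisfies \<open>\<bar>p\<^sub>k(x\<^sub>i)\<bar> \<le> 1\<close>:
  the optimal vector \<open>a\<^bsup>(k)\<^esup>\<close> vanishes nowhere on \<open>S\<^sub>k\<close>, so \<open>\<bar>p\<^sub>k(x\<^sub>i)\<bar> > 1\<close> would allow its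
  \<open>l\<^sub>1\<close>-norm to be decreased by moving along the kernel vector \<open>e\<^sub>i - \<Sum>\<^sub>j l\<^sub>j(x\<^sub>i) e\<^sub>j\<close>.\<close>

section \<open>Interpolation in Chebyshev spaces\<close>

lemma app_zero [simp]: "app 0 t = 0"
  by transfer simp

lemma app_add [simp]: "app (f + g) t = app f t + app g t"
  by transfer simp

lemma app_scaleR [simp]: "app (c *\<^sub>R f) t = c * app f t"
  by transfer simp

lemma app_sum [simp]: "app (\<Sum>i\<in>I. f i) t = (\<Sum>i\<in>I. app (f i) t)"
  by (induction I rule: infinite_finite_induct) auto

lemma continuous_on_app: "continuous_on {-1..1} (app f)"
  by transfer simp

lemma bounded_app: "bdd_above ((\<lambda>t. \<bar>app f t\<bar>) ` {-1..1})"
  by (intro bounded_imp_bdd_above compact_imp_bounded compact_continuous_image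
      continuous_on_rabs continuous_on_app) auto

text \<open>The definition of a Chebyshev space speaks of the indices \<open>{1..n}\<close>. A
  bijection onto \<open>I\<close> carries it over to node sets that keep their own indices, as the
  sets \<open>S k\<close> do.\<close>

lemma chebyshev_interpolation:
  assumes "chebyshev_space n V" "finite I" "card I = n" "inj_on x I" "x ` I \<subseteq> {-1..1}"
  shows "\<exists>!f. f \<in> V \<and> (\<forall>i\<in>I. app f (x i) = \<gamma> i)"
proof -
  obtain h where h: "bij_betw h {1..n} I"
    using ex_bij_betw_nat_finite_1[OF assms(2)] assms(3) by blast
  have "inj_on (x \<circ> h) {1..n}"
    using h assms(4) by (simp add: bij_betw_def comp_inj_on)
  moreover have "(x \<circ> h) ` {1..n} \<subseteq> {-1..1}"
    using h assms(5) by (metis bij_betw_imp_surj_on image_comp)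
  ultimately have "\<exists>!f. f \<in> V \<and> (\<forall>i\<in>{1..n}. app f ((x \<circ> h) i) = (\<gamma> \<circ> h) i)"
    using assms(1) unfolding chebyshev_space_def by (elim conjE allE[of _ "x \<circ> h"] allE[of _ "\<gamma> \<circ> h"]) simp
  moreover have "(\<forall>i\<in>{1..n}. app f ((x \<circ> h) i) = (\<gamma> \<circ> h) i) \<longleftrightarrow> (\<forall>i\<in>I. app f (x i) = \<gamma> i)" for f
    unfolding bij_betw_imp_surj_on[OF h, symmetric] by simp
  ultimately show ?thesis by simp
qed

lemma chebyshev_eqI:
  assumes "chebyshev_space n V" "finite I" "card I = n" "inj_on x I" "x ` I \<subseteq> {-1..1}"
    and "f \<in> V" "g \<in> V" "\<And>i. i \<in> I \<Longrightarrow> app f (x i) = app g (x i)"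
  shows "f = g"
  using chebyshev_interpolation[OF assms(1-5), of "\<lambda>i. app g (x i)"] assms(6-8) by blast

text \<open>One fixed node set; the results are later instantiated at every \<open>S k\<close>. The
  nodes need only be distinct, their order does not enter.\<close>

locale chebyshev_nodes =
  fixes n :: nat and V :: "C11 set" and v :: "nat \<Rightarrow> C11" and x :: "nat \<Rightarrow> real" and S :: "nat set"
  assumes cheb: "chebyshev_space n V" and basis: "is_basis n v V"
    and finS: "finite S" and cardS: "card S = n" and injS: "inj_on x S" and xS: "x ` S \<subseteq> {-1..1}"
begin

section \<open>Basis coefficients and the inverse collocation matrix\<close>

lemma subspace: "subspace V"
  using cheb by (simp add: chebyshev_space_def)

lemma v_in: "i \<in> {1..n} \<Longrightarrow> v i \<in> V"
  using basis span_superset[of "v ` {1..n}"] by (auto simp: is_basis_def)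

lemma basis_expansion:
  assumes "f \<in> V"
  obtains c where "f = (\<Sum>i\<in>{1..n}. c i *\<^sub>R v i)"
proof -
  have "f \<in> span (v ` {1..n})" "inj_on v {1..n}"
    using assms basis by (auto simp: is_basis_def)
  then obtain u where "f = (\<Sum>w\<in>v ` {1..n}. u w *\<^sub>R w)"
    using span_finite[of "v ` {1..n}"] by blast
  then have "f = (\<Sum>i\<in>{1..n}. u (v i) *\<^sub>R v i)"
    using \<open>inj_on v {1..n}\<close> by (simp add: sum.reindex)
  then show ?thesis by (rule that)
qed

lemma basis_coeffs_eq_0:
  assumes "(\<Sum>i\<in>{1..n}. c i *\<^sub>R v i) = 0" "i \<in> {1..n}"
  shows "c i = 0"
proof -
  have inj: "inj_on v {1..n}" and ind: "independent (v ` {1..n})"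
    using basis by (auto simp: is_basis_def)
  have "(\<Sum>w\<in>v ` {1..n}. c (the_inv_into {1..n} v w) *\<^sub>R w) = 0"
    using assms(1) inj by (simp add: sum.reindex the_inv_into_f_f)
  then have "c (the_inv_into {1..n} v (v i)) = 0"
    by (intro independentD[OF ind, of "v ` {1..n}" "\<lambda>w. c (the_inv_into {1..n} v w)"])
      (use assms(2) in auto)
  then show ?thesis
    using inj assms(2) by (simp add: the_inv_into_f_f)
qed

text \<open>Since \<open>mat_inverse\<close> is a choice, some inverse has to be exhibited. Row
  \<open>j\<close> of \<open>B\<close> holds the basis coefficients of the element of
  \<open>V\<close> that interpolates the \<open>j\<close>-th unit data, so \<open>B\<close> is a
  left inverse by construction. It is a right inverse because interpolation reproduces each
  \<open>v i\<close>.\<close>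

lemma is_mat_inverse_mat_inverse:
  "is_mat_inverse {1..n} S (colloc_mat v x) (mat_inverse {1..n} S (colloc_mat v x))"
proof -
  have "\<forall>j. \<exists>c. \<forall>l\<in>S. app (\<Sum>i\<in>{1..n}. c i *\<^sub>R v i) (x l) = (if j = l then 1 else 0)"
  proof
    fix j
    obtain f where f: "f \<in> V" "\<forall>l\<in>S. app f (x l) = (if j = l then 1 else 0)"
      using chebyshev_interpolation[OF cheb finS cardS injS xS, of "\<lambda>l. if j = l then 1 else 0"]
      by (auto elim: ex1E)
    obtain c where "f = (\<Sum>i\<in>{1..n}. c i *\<^sub>R v i)"
      using f(1) by (rule basis_expansion)
    with f(2) show "\<exists>c. \<forall>l\<in>S. app (\<Sum>i\<in>{1..n}. c i *\<^sub>R v i) (x l) = (if j = l then 1 else 0)"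
      by (intro exI[of _ c]) (simp only:)
  qed
  from choice[OF this] obtain B where
    "\<forall>j. \<forall>l\<in>S. app (\<Sum>i\<in>{1..n}. B j i *\<^sub>R v i) (x l) = (if j = l then 1 else 0)"
    by (rule exE)
  then have B: "app (\<Sum>i\<in>{1..n}. B j i *\<^sub>R v i) (x l) = (if j = l then 1 else 0)"
    if "l \<in> S" for j l
    using that by blast
  have left: "(\<Sum>i\<in>{1..n}. B j i * colloc_mat v x i l) = (if j = l then 1 else 0)"
    if "l \<in> S" for j l
    using B[OF that, of j] by (simp add: colloc_mat_def)
  have right: "(\<Sum>j\<in>S. colloc_mat v x i j * B j k) = (if i = k then 1 else 0)"
    if i: "i \<in> {1..n}" and k: "k \<in> {1..n}" for i k
  proof -
    \<comment> \<open>The interpolant of \<open>v i\<close> at the nodes. Uniqueness gives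
      \<open>?g = v i\<close>, and the coefficients of \<open>?g\<close> in the basis are the
      entries of row \<open>i\<close> of the product of the collocation matrix with
      \<open>B\<close>.\<close>
    let ?g = "\<Sum>j\<in>S. app (v i) (x j) *\<^sub>R (\<Sum>k\<in>{1..n}. B j k *\<^sub>R v k)"
    have "?g \<in> V"
      using subspace by (intro subspace_sum subspace_scale v_in) auto
    moreover have "app ?g (x l) = app (v i) (x l)" if l: "l \<in> S" for l
    proof -
      have "app ?g (x l) = (\<Sum>j\<in>S. app (v i) (x j) * app (\<Sum>k\<in>{1..n}. B j k *\<^sub>R v k) (x l))"
        by simp
      also have "\<dots> = (\<Sum>j\<in>S. if j = l then app (v i) (x j) else 0)"
        by (intro sum.cong refl) (simp only: B[OF l], simp)
      also have "\<dots> = app (v i) (x l)"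
        using finS l by simp
      finally show ?thesis .
    qed
    ultimately have "?g = v i"
      using chebyshev_eqI[OF cheb finS cardS injS xS] v_in[OF i] by blast
    moreover have "?g = (\<Sum>k\<in>{1..n}. (\<Sum>j\<in>S. app (v i) (x j) * B j k) *\<^sub>R v k)"
      by (simp add: scaleR_sum_right scaleR_sum_left) (rule sum.swap)
    moreover have "v i = (\<Sum>k\<in>{1..n}. (if i = k then 1 else 0) *\<^sub>R v k)"
      using i by (simp add: if_distrib[of "\<lambda>c. c *\<^sub>R _"] cong: if_cong)
    ultimately have "(\<Sum>k\<in>{1..n}. ((\<Sum>j\<in>S. app (v i) (x j) * B j k) - (if i = k then 1 else 0)) *\<^sub>R v k) = 0"
      by (simp only: scaleR_diff_left sum_subtractf) simp
    from basis_coeffs_eq_0[OF this k] show ?thesis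
      by (simp add: colloc_mat_def)
  qed
  from left right have "is_mat_inverse {1..n} S (colloc_mat v x) B"
    by (simp add: is_mat_inverse_def)
  then show ?thesis
    unfolding mat_inverse_def by (rule someI[of "is_mat_inverse {1..n} S (colloc_mat v x)"])
qed

section \<open>Lagrange functions of the nodes\<close>

definition lagrange :: "nat \<Rightarrow> C11" where
  "lagrange j = (\<Sum>i\<in>{1..n}. mat_inverse {1..n} S (colloc_mat v x) j i *\<^sub>R v i)"

lemma lagrange_in: "lagrange j \<in> V"
  unfolding lagrange_def using subspace by (intro subspace_sum subspace_scale v_in) auto

text \<open>From here on matrix expressions are values of fixed elements of \<open>V\<close>, to
  which interpolation and continuity apply.\<close>

lemma inv_eval_eq: "inv_eval n v x S t j = app (lagrange j) t"
  by (simp add: inv_eval_def mat_vec_def eval_vec_def lagrange_def)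

lemma lagrange_node: "j \<in> S \<Longrightarrow> l \<in> S \<Longrightarrow> app (lagrange j) (x l) = (if j = l then 1 else 0)"
  using is_mat_inverse_mat_inverse by (simp add: lagrange_def is_mat_inverse_def colloc_mat_def)

lemma sum_lagrange_node:
  assumes "l \<in> S" shows "(\<Sum>j\<in>S. c j * app (lagrange j) (x l)) = c l"
proof -
  have "(\<Sum>j\<in>S. c j * app (lagrange j) (x l)) = (\<Sum>j\<in>S. if j = l then c j else 0)"
    by (intro sum.cong refl) (simp add: lagrange_node assms)
  then show ?thesis using finS assms by simp
qed

lemma lagrange_expansion:
  assumes "f \<in> V" shows "app f t = (\<Sum>j\<in>S. app f (x j) * app (lagrange j) t)"
proof -
  have "(\<Sum>j\<in>S. app f (x j) *\<^sub>R lagrange j) = f"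
    using subspace
    by (intro chebyshev_eqI[OF cheb finS cardS injS xS] assms subspace_sum subspace_scale lagrange_in)
      (simp_all add: sum_lagrange_node)
  then have "app f t = app (\<Sum>j\<in>S. app f (x j) *\<^sub>R lagrange j) t" by simp
  then show ?thesis by simp
qed

text \<open>A zero at \<open>t\<close>, together with the zeros at the other \<open>n - 1\<close>
  nodes, would give \<open>n\<close> distinct zeros. The points \<open>?y\<close> are the nodes with
  the \<open>j\<close>-th one replaced by \<open>t\<close>.\<close>

lemma lagrange_nonzero:
  assumes j: "j \<in> S" and t: "t \<in> {-1..1}" "t \<notin> x ` S"
  shows "app (lagrange j) t \<noteq> 0"
proof
  assume zero: "app (lagrange j) t = 0"
  let ?y = "x(j := t)"
  have "?y ` S \<subseteq> {-1..1}"
    using xS t(1) unfolding image_subset_iff by simp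
  moreover have "inj_on ?y S"
    using injS t(2) by (rule inj_on_fun_updI)
  moreover have "app (lagrange j) (?y l) = app 0 (?y l)" if "l \<in> S" for l
    using zero lagrange_node[OF j that] by simp
  ultimately have "lagrange j = 0"
    using chebyshev_eqI[OF cheb finS cardS] lagrange_in subspace_0[OF subspace] by blast
  then show False using lagrange_node[OF j j] by simp
qed

text \<open>There is no zero inside the open interval, so a change of sign contradicts the
  intermediate value theorem. The closed interval is allowed for \<open>t\<close> because its
  endpoints may be nodes, where the value can be 0.\<close>

lemma lagrange_sgn_const:
  assumes j: "j \<in> S" and "{p..q} \<subseteq> {-1..1}" and free: "{p<..<q} \<inter> x ` S = {}"
    and z: "z \<in> {p<..<q}" and t: "t \<in> {p..q}"
  shows "sgn (app (lagrange j) z) * app (lagrange j) t = \<bar>app (lagrange j) t\<bar>"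
proof -
  let ?f = "\<lambda>s. sgn (app (lagrange j) z) * app (lagrange j) s"
  have cont: "continuous_on {p..q} ?f"
    by (intro continuous_intros continuous_on_subset[OF continuous_on_app] assms)
  have nz: "app (lagrange j) s \<noteq> 0" if "s \<in> {p<..<q}" for s
  proof (rule lagrange_nonzero[OF j])
    show "s \<in> {-1..1}" using that assms(2) by (auto simp: subset_iff)
    show "s \<notin> x ` S" using that free by blast
  qed
  have pos: "?f z > 0" using nz[OF z] by (simp add: sgn_if)
  have "?f t \<ge> 0"
  proof (rule ccontr)
    assume neg: "\<not> ?f t \<ge> 0"
    have "\<exists>s\<in>{p<..<q}. ?f s = 0"
    proof (cases "t \<le> z")
      case True
      then obtain s where s: "t \<le> s" "s \<le> z" "?f s = 0"
        using IVT'[of ?f t 0 z] continuous_on_subset[OF cont, of "{t..z}"] neg pos t z by auto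
      \<comment> \<open>Even if \<open>t\<close> is an endpoint, this puts \<open>s\<close> strictly
        inside the interval.\<close>
      with neg have "s \<noteq> t" by auto
      then show ?thesis using s z t by (intro bexI[of _ s]) auto
    next
      case False
      then obtain s where s: "z \<le> s" "s \<le> t" "?f s = 0"
        using IVT2'[of ?f t 0 z] continuous_on_subset[OF cont, of "{z..t}"] neg pos t z by auto
      with neg have "s \<noteq> t" by auto
      then show ?thesis using s z t by (intro bexI[of _ s]) auto
    qed
    then show False using nz z by (auto simp: sgn_0_0)
  qed
  then have "?f t = \<bar>?f t\<bar>" by simp
  also have "\<dots> = \<bar>app (lagrange j) t\<bar>"
    using nz[OF z] by (simp add: abs_mult abs_sgn_eq)
  finally show ?thesis .
qed

section \<open>The sign interpolant and the Lebesgue function\<close>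

definition sign_interpolant :: "real \<Rightarrow> C11" where
  "sign_interpolant z = (\<Sum>j\<in>S. sgn (app (lagrange j) z) *\<^sub>R lagrange j)"

lemma sign_interpolant_in: "sign_interpolant z \<in> V"
  unfolding sign_interpolant_def using subspace
  by (intro subspace_sum subspace_scale lagrange_in) auto

lemma sign_sum_eq: "sign_sum n v x S z t = app (sign_interpolant z) t"
  by (simp add: sign_sum_def sign_interpolant_def inv_eval_eq)

lemma sign_interpolant_node:
  "l \<in> S \<Longrightarrow> app (sign_interpolant z) (x l) = sgn (app (lagrange l) z)"
  by (simp add: sign_interpolant_def sum_lagrange_node)

text \<open>Lagrange expansion bounds the left side by \<open>D\<close> times the Lebesgue function
  of the nodes, which coincides with the sign interpolant on this interval.\<close>

lemma app_le_sign_interpolant: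
  assumes "f \<in> V" and D: "\<And>j. j \<in> S \<Longrightarrow> \<bar>app f (x j)\<bar> \<le> D"
    and "{p..q} \<subseteq> {-1..1}" "{p<..<q} \<inter> x ` S = {}" "z \<in> {p<..<q}" "t \<in> {p..q}"
  shows "\<bar>app f t\<bar> \<le> D * app (sign_interpolant z) t"
proof -
  have "\<bar>app f t\<bar> \<le> (\<Sum>j\<in>S. \<bar>app f (x j) * app (lagrange j) t\<bar>)"
    by (subst lagrange_expansion[OF assms(1)]) (rule sum_abs)
  also have "\<dots> \<le> (\<Sum>j\<in>S. D * \<bar>app (lagrange j) t\<bar>)"
    by (intro sum_mono) (auto simp: abs_mult intro: mult_right_mono D)
  also have "\<dots> = D * app (sign_interpolant z) t"
    using lagrange_sgn_const[OF _ assms(3-6)] by (simp add: sign_interpolant_def sum_distrib_left)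
  finally show ?thesis .
qed

section \<open>Optimality of the sign interpolant\<close>

text \<open>In terms of linear programming duality, the sign interpolant is the dual vector of the
  minimizer, and the bound is its dual feasibility.\<close>

lemma abs_sign_interpolant_le_1:
  assumes Sm: "S \<subseteq> {1..m}" and z: "z \<in> {-1..1}" "z \<notin> x ` S"
    and a0: "\<And>i. i \<in> {1..m} \<Longrightarrow> i \<notin> S \<Longrightarrow> a i = 0"
    and aS: "\<And>i. i \<in> S \<Longrightarrow> a i = app (lagrange i) z"
    and sol: "l1_solution n m (colloc_mat v x) (eval_vec v z) a"
    and i: "i \<in> {1..m}"
  shows "\<bar>app (sign_interpolant z) (x i)\<bar> \<le> 1"
proof (cases "i \<in> S")
  case True
  then show ?thesis by (simp add: sign_interpolant_node sgn_if)
next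
  case False
  define c where "c j = app (lagrange j) (x i)" for j
  define P where "P = app (sign_interpolant z) (x i)"
  have P: "P = (\<Sum>j\<in>S. sgn (a j) * c j)"
    by (simp add: P_def sign_interpolant_def c_def aS)
  have nz: "a j \<noteq> 0" if "j \<in> S" for j
    using that lagrange_nonzero[OF that z] by (simp add: aS)
  \<comment> \<open>A step this short changes no sign on \<open>S\<close>, so the change of the norm
    is linear in \<open>e\<close>.\<close>
  have "\<forall>\<^sub>F e in at_right 0. \<forall>j\<in>S. \<bar>e * sgn P * c j\<bar> < \<bar>a j\<bar>"
  proof (intro eventually_ball_finite finS ballI)
    fix j assume "j \<in> S"
    have "((\<lambda>e. \<bar>e * sgn P * c j\<bar>) \<longlongrightarrow> \<bar>0 * sgn P * c j\<bar>) (at_right 0)"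
      by (intro tendsto_intros)
    then show "\<forall>\<^sub>F e in at_right 0. \<bar>e * sgn P * c j\<bar> < \<bar>a j\<bar>"
      using nz[OF \<open>j \<in> S\<close>] by (intro order_tendstoD) auto
  qed
  then have "\<forall>\<^sub>F e in at_right 0. e > 0 \<and> (\<forall>j\<in>S. \<bar>e * sgn P * c j\<bar> < \<bar>a j\<bar>)"
    using eventually_at_right_less[of "0::real"] by eventually_elim auto
  then obtain e :: real where e: "e > 0" and small: "\<And>j. j \<in> S \<Longrightarrow> \<bar>e * sgn P * c j\<bar> < \<bar>a j\<bar>"
    using eventually_happens' trivial_limit_at_right_real by (metis (no_types, lifting))
  \<comment> \<open>The kernel direction is scaled by \<open>e * sgn P\<close>, so that the norm
    changes by \<open>e\<close> times the difference of \<open>\<bar>sgn P\<bar>\<close> and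
    \<open>\<bar>P\<bar>\<close>.\<close>
  define a' where "a' l = (if l \<in> S then a l - e * sgn P * c l else if l = i then e * sgn P else 0)" for l
  have a'_i: "a' i = e * sgn P"
    using False by (simp add: a'_def)
  have split: "(\<Sum>l\<in>{1..m}. g l) = (\<Sum>l\<in>S. g l) + g i"
    if "\<And>l. l \<in> {1..m} \<Longrightarrow> l \<notin> S \<Longrightarrow> l \<noteq> i \<Longrightarrow> g l = 0" for g :: "nat \<Rightarrow> real"
  proof -
    have "(\<Sum>l\<in>{1..m}. g l) = (\<Sum>l\<in>insert i S. g l)"
      using Sm i that by (intro sum.mono_neutral_right) auto
    then show ?thesis using False finS by simp
  qed
  have "l1_feasible n m (colloc_mat v x) (eval_vec v z) a'"
    unfolding l1_feasible_def
  proof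
    fix k assume k: "k \<in> {1..n}"
    have "mat_vec {1..m} (colloc_mat v x) a' k = (\<Sum>l\<in>S. app (v k) (x l) * a' l) + app (v k) (x i) * a' i"
      unfolding mat_vec_def colloc_mat_def by (rule split) (simp add: a'_def)
    also have "(\<Sum>l\<in>S. app (v k) (x l) * a' l)
        = (\<Sum>l\<in>S. app (v k) (x l) * app (lagrange l) z)
          - e * sgn P * (\<Sum>l\<in>S. app (v k) (x l) * app (lagrange l) (x i))"
      by (simp add: a'_def aS c_def algebra_simps sum_subtractf sum_distrib_left)
    \<comment> \<open>The last sum is the Lagrange expansion of \<open>v k\<close> at
      \<open>x i\<close> and cancels the contribution of \<open>a' i\<close>.\<close>
    finally show "mat_vec {1..m} (colloc_mat v x) a' k = eval_vec v z k"
      using False by (simp add: a'_i eval_vec_def flip: lagrange_expansion[OF v_in[OF k]])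
  qed
  then have "l1_norm m a \<le> l1_norm m a'"
    using sol by (simp add: l1_solution_def)
  also have "l1_norm m a' = (\<Sum>l\<in>S. \<bar>a' l\<bar>) + \<bar>a' i\<bar>"
    unfolding l1_norm_def by (rule split) (simp add: a'_def)
  also have "l1_norm m a = (\<Sum>l\<in>S. \<bar>a l\<bar>)"
    unfolding l1_norm_def using split[of "\<lambda>l. \<bar>a l\<bar>"] a0 False i by simp
  also have "(\<Sum>l\<in>S. \<bar>a' l\<bar>) = (\<Sum>l\<in>S. \<bar>a l\<bar> - e * sgn P * (sgn (a l) * c l))"
  proof (intro sum.cong refl)
    fix l assume l: "l \<in> S"
    show "\<bar>a' l\<bar> = \<bar>a l\<bar> - e * sgn P * (sgn (a l) * c l)"
      using small[OF l] nz[OF l] l by (cases "a l > 0") (auto simp: a'_def abs_if split: if_splits)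
  qed
  also have "\<dots> = (\<Sum>l\<in>S. \<bar>a l\<bar>) - e * sgn P * P"
    by (simp add: sum_subtractf P sum_distrib_left)
  also have "\<bar>a' i\<bar> = e * \<bar>sgn P\<bar>"
    using e by (simp add: a'_i abs_mult)
  finally have "e * (sgn P * P) \<le> e * \<bar>sgn P\<bar>" by (simp add: mult.assoc)
  then have "sgn P * P \<le> \<bar>sgn P\<bar>" using e by simp
  then show ?thesis unfolding P_def[symmetric] by (auto simp: sgn_if split: if_splits)
qed

end

section \<open>The maximal ratio\<close>

text \<open>Induction from the left, without monotonicity. If the first \<open>N\<close> intervals
  do not settle the claim, then \<open>x N\<close> is at most \<open>x 0\<close> or lies left of
  \<open>t\<close>; in both cases the last interval is nondegenerate and contains \<open>t\<close>.
  Degenerate intervals occur when -1 or 1 is itself a node.\<close>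

lemma interval_cover:
  fixes x :: "nat \<Rightarrow> real"
  assumes "x 0 < x N" "t \<in> {x 0..x N}"
  shows "\<exists>k\<in>{1..N}. x (k - 1) < x k \<and> t \<in> {x (k - 1)..x k}"
  using assms
proof (induction N)
  case 0
  then show ?case by simp
next
  case (Suc N)
  show ?case
  proof (cases "x 0 < x N \<and> t \<le> x N")
    case True
    then have "\<exists>k\<in>{1..N}. x (k - 1) < x k \<and> t \<in> {x (k - 1)..x k}"
      using Suc by auto
    then show ?thesis by (auto intro!: bexI)
  next
    case False
    then show ?thesis using Suc.prems by (intro bexI[of _ "Suc N"]) auto
  qed
qed

theorem mainTheorem4:
  fixes m n :: nat
    and V :: "C11 set" and v :: "nat \<Rightarrow> C11"
    and x z :: "nat \<Rightarrow> real"
    and K :: "nat set" and S :: "nat \<Rightarrow> nat set"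
    and a :: "nat \<Rightarrow> nat \<Rightarrow> real"
  assumes "n \<ge> 3" and "m \<ge> n"
    and "chebyshev_space n V"
    and "\<And>c. const_C11 c \<in> V"
    and "is_basis n v V"
    and "\<And>i. i \<in> {1..m} \<Longrightarrow> x i \<in> {-1..1}"
    and "strict_mono_on {1..m} x"
    and "x 0 = -1" and "x (m + 1) = 1"
    and "K = {k \<in> {1..m + 1}. x (k - 1) < x k}"
    and "\<And>k. k \<in> K \<Longrightarrow> z k \<in> {x (k - 1)<..<x k}"
    and "\<And>k. k \<in> K \<Longrightarrow> S k \<subseteq> {1..m}"
    and "\<And>k. k \<in> K \<Longrightarrow> card (S k) = n"
    and "\<And>k i. k \<in> K \<Longrightarrow> i \<in> {1..m} \<Longrightarrow> i \<notin> S k \<Longrightarrow> a k i = 0"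
    and "\<And>k i. k \<in> K \<Longrightarrow> i \<in> S k \<Longrightarrow> a k i = inv_eval n v x (S k) (z k) i"
    and "\<And>k. k \<in> K \<Longrightarrow> l1_solution n m (colloc_mat v x) (eval_vec v (z k)) (a k)"
  shows "attains_max (V - {0}) (norm_ratio m x) \<and>
    (\<forall>k\<in>K. attains_max {x (k - 1)..x k} (sign_sum n v x (S k) (z k))) \<and>
    max_ratio V m x =
      Max ((\<lambda>k. SUP t\<in>{x (k - 1)..x k}. sign_sum n v x (S k) (z k) t) ` K)"
proof -
  note cheb = assms(3) and basis = assms(5) and xin = assms(6) and mono = assms(7) and K = assms(10)
    and zin = assms(11) and Sm = assms(12) and Sn = assms(13)
  define p where "p k = chebyshev_nodes.sign_interpolant n v x (S k) (z k)" for k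
  define J where "J k = {x (k - 1)..x k}" for k
  have inj: "inj_on x {1..m}"
    using mono by (rule strict_mono_on_imp_inj_on)
  have xle: "x i \<le> x j" if "i \<in> {1..m}" "j \<in> {1..m}" "i \<le> j" for i j
    using mono that by (metis order_le_less strict_mono_onD)
  have nodes: "chebyshev_nodes n V v x (S k)" if k: "k \<in> K" for k
  proof
    show "finite (S k)" using Sm[OF k] by (rule finite_subset) simp
    show "inj_on x (S k)" using inj Sm[OF k] by (rule inj_on_subset)
    show "x ` S k \<subseteq> {-1..1}" using xin Sm[OF k] by auto
  qed (use cheb basis Sn[OF k] in auto)
  have xin': "x i \<in> {-1..1}" if "i \<le> m + 1" for i
    using that xin[of i] assms(8,9) by (cases "i = 0"; cases "i = m + 1") auto
  have Jsub: "J k \<subseteq> {-1..1}" if "k \<in> K" for k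
    using that xin'[of "k - 1"] xin'[of k] by (auto simp: K J_def)
  \<comment> \<open>The added points \<open>x 0\<close> and \<open>x (m + 1)\<close> make no
    exception: for \<open>k = 1\<close> all nodes lie to the right of the interval, for
    \<open>k = m + 1\<close> all lie to the left.\<close>
  have free: "{x (k - 1)<..<x k} \<inter> x ` {1..m} = {}" if "k \<in> K" for k
  proof -
    have "x i \<le> x (k - 1) \<or> x k \<le> x i" if i: "i \<in> {1..m}" for i
      using \<open>k \<in> K\<close> i xle[of i "k - 1"] xle[of k i] xin[OF i] assms(9)
      by (cases "i \<le> k - 1"; cases "k = m + 1") (auto simp: K)
    then show ?thesis by force
  qed
  have freeS: "{x (k - 1)<..<x k} \<inter> x ` S k = {}" if "k \<in> K" for k
    using free[OF that] Sm[OF that] by blast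
  have zin': "z k \<in> {-1..1}" "z k \<notin> x ` S k" if "k \<in> K" for k
    using zin[OF that] Jsub[OF that] freeS[OF that] by (auto simp: J_def)
  have pV: "p k \<in> V" if "k \<in> K" for k
    unfolding p_def by (rule chebyshev_nodes.sign_interpolant_in[OF nodes[OF that]])
  have p_eq: "sign_sum n v x (S k) (z k) = app (p k)" if "k \<in> K" for k
    unfolding p_def by (rule ext) (rule chebyshev_nodes.sign_sum_eq[OF nodes[OF that]])
  have p_le: "\<bar>app (p k) (x i)\<bar> \<le> 1" if k: "k \<in> K" and i: "i \<in> {1..m}" for k i
    unfolding p_def
    by (rule chebyshev_nodes.abs_sign_interpolant_le_1[OF nodes[OF k] Sm[OF k] zin'[OF k]
          assms(14)[OF k] _ assms(16)[OF k] i])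
      (simp_all add: assms(15)[OF k] chebyshev_nodes.inv_eval_eq[OF nodes[OF k]])
  \<comment> \<open>With \<open>p_le\<close> this makes the discrete norm of \<open>p k\<close>
    exactly 1, so that its ratio is its uniform norm.\<close>
  have p_node: "\<exists>i\<in>{1..m}. \<bar>app (p k) (x i)\<bar> = 1" if k: "k \<in> K" for k
  proof -
    have "S k \<noteq> {}" using Sn[OF k] assms(1) by auto
    then obtain i where i: "i \<in> S k" by blast
    have "\<bar>app (p k) (x i)\<bar> = 1"
      using chebyshev_nodes.lagrange_nonzero[OF nodes[OF k] i zin'[OF k]]
      by (simp add: p_def chebyshev_nodes.sign_interpolant_node[OF nodes[OF k] i] abs_sgn_eq)
    then show ?thesis using i Sm[OF k] by blast
  qed
  have att: "\<exists>t\<in>J k. \<forall>s\<in>J k. app (p k) s \<le> app (p k) t" if k: "k \<in> K" for k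
    using k unfolding J_def
    by (intro continuous_attains_sup continuous_on_subset[OF continuous_on_app])
      (use Jsub[OF k] in \<open>auto simp: K J_def\<close>)
  define Q where "Q k = (SUP t\<in>J k. app (p k) t)" for k
  have Q_attained: "\<exists>t\<in>J k. app (p k) t = Q k" and Q_upper: "\<And>t. t \<in> J k \<Longrightarrow> app (p k) t \<le> Q k"
    if k: "k \<in> K" for k
  proof -
    obtain t where t: "t \<in> J k" "\<And>s. s \<in> J k \<Longrightarrow> app (p k) s \<le> app (p k) t"
      using att[OF k] by blast
    then have "Q k = app (p k) t"
      unfolding Q_def by (intro cSup_eq_maximum) auto
    then show "\<exists>t\<in>J k. app (p k) t = Q k" "\<And>t. t \<in> J k \<Longrightarrow> app (p k) t \<le> Q k"
      using t by auto
  qed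
  have cover: "\<exists>k\<in>K. t \<in> J k" if "t \<in> {-1..1}" for t
    using interval_cover[of x "m + 1" t] that assms(8,9) by (auto simp: K J_def)
  have "finite K" by (simp add: K)
  moreover have "K \<noteq> {}" using cover[of 0] by auto
  \<comment> \<open>The interval with the largest \<open>Q\<close>; \<open>p k0\<close> will be an
    extremal function.\<close>
  ultimately obtain k0 where k0: "k0 \<in> K" and Qk0: "Max (Q ` K) = Q k0"
    by (metis (no_types, lifting) Max_in finite_imageI image_iff image_is_empty)
  have Q_le: "Q k \<le> Q k0" if "k \<in> K" for k
    using Max_ge[of "Q ` K" "Q k"] \<open>finite K\<close> that Qk0 by auto
  have disc: "\<bar>app f (x i)\<bar> \<le> discrete_norm m x f" if "i \<in> {1..m}" for f i
    unfolding discrete_norm_def using that by (intro Max_ge) auto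
  have upper: "norm_ratio m x f \<le> Q k0" if f: "f \<in> V - {0}" for f
  proof -
    have D0: "discrete_norm m x f \<ge> 0"
      using disc[of 1 f] assms(1,2) by auto
    \<comment> \<open>Otherwise \<open>f\<close> would vanish at the \<open>n\<close> nodes of
      \<open>S k0\<close> and be 0.\<close>
    have "discrete_norm m x f \<noteq> 0"
    proof
      assume "discrete_norm m x f = 0"
      then have "app f (x i) = app 0 (x i)" if "i \<in> S k0" for i
        using disc[of i f] that Sm[OF k0] by auto
      moreover have "0 \<in> V" using chebyshev_nodes.subspace[OF nodes[OF k0]] by (rule subspace_0)
      ultimately have "f = 0"
        using chebyshev_nodes.finS[OF nodes[OF k0]] chebyshev_nodes.injS[OF nodes[OF k0]]
          chebyshev_nodes.xS[OF nodes[OF k0]] f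
        by (intro chebyshev_eqI[OF cheb _ Sn[OF k0], of x]) auto
      with f show False by simp
    qed
    with D0 have Dpos: "discrete_norm m x f > 0" by simp
    have "\<bar>app f t\<bar> \<le> discrete_norm m x f * Q k0" if t: "t \<in> {-1..1}" for t
    proof -
      \<comment> \<open>The comparison function depends on the interval containing \<open>t\<close>;
        only its maximum \<open>Q k\<close> is compared with \<open>Q k0\<close>.\<close>
      obtain k where k: "k \<in> K" "t \<in> J k" using cover[OF t] by blast
      have "\<bar>app f t\<bar> \<le> discrete_norm m x f * app (p k) t"
        unfolding p_def
      proof (rule chebyshev_nodes.app_le_sign_interpolant[OF nodes[OF k(1)] _ _ _
            freeS[OF k(1)] zin[OF k(1)]])
        show "f \<in> V" using f by simp
        show "\<bar>app f (x j)\<bar> \<le> discrete_norm m x f" if "j \<in> S k" for j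
          using that Sm[OF k(1)] by (intro disc) blast
      qed (use k Jsub[OF k(1)] in \<open>simp_all add: J_def\<close>)
      also have "\<dots> \<le> discrete_norm m x f * Q k0"
        using D0 Q_upper[OF k] Q_le[OF k(1)] by (intro mult_left_mono) auto
      finally show ?thesis .
    qed
    then have "uniform_norm f \<le> discrete_norm m x f * Q k0"
      unfolding uniform_norm_def by (intro cSUP_least) auto
    then show ?thesis
      using Dpos by (simp add: norm_ratio_def field_simps)
  qed
  have p0: "p k0 \<in> V - {0}" using pV[OF k0] p_node[OF k0] by auto
  have "discrete_norm m x (p k0) = 1"
    unfolding discrete_norm_def using p_node[OF k0] p_le[OF k0] by (intro Max_eqI) force+
  moreover have "Q k0 \<le> uniform_norm (p k0)"
  proof -
    obtain t where t: "t \<in> J k0" "app (p k0) t = Q k0" using Q_attained[OF k0] by blast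
    have "Q k0 \<le> \<bar>app (p k0) t\<bar>" using t by simp
    also have "\<dots> \<le> uniform_norm (p k0)"
      unfolding uniform_norm_def using t Jsub[OF k0] by (intro cSUP_upper bounded_app) auto
    finally show ?thesis .
  qed
  \<comment> \<open>The reverse inequality is \<open>upper\<close> applied to \<open>p k0\<close>
    itself.\<close>
  ultimately have ratio_p: "norm_ratio m x (p k0) = Q k0"
    using upper[OF p0] by (simp add: norm_ratio_def)
  have "attains_max (V - {0}) (norm_ratio m x)"
    unfolding attains_max_def using p0 upper ratio_p by (intro bexI[of _ "p k0"]) auto
  moreover have "max_ratio V m x = Q k0"
    unfolding max_ratio_def using p0 upper ratio_p
    by (intro cSup_eq_maximum) (auto intro: image_eqI[of _ _ "p k0"])
  moreover have "(\<lambda>k. SUP t\<in>{x (k - 1)..x k}. sign_sum n v x (S k) (z k) t) ` K = Q ` K"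
    by (intro image_cong refl) (simp add: p_eq Q_def J_def)
  ultimately show ?thesis
    using att Qk0 by (simp add: attains_max_def p_eq J_def)
qed

end
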